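(* Let $k$ be a commutative ring with unit and let $(A,\star,\alpha)$ be a hom-associative $k$-algebra which is not strongly degenerate and whose twisting map $\alpha$ is surjective. Then every formal hom-associative deformation $(A[[t]],\mu_t,\alpha_t)$ of $(A,\star,\alpha)$ is a twist, i.e. there is an associative multiplication $\cdot:A[[t]]\times A[[t]]\to A[[t]]$ such that $\mu_t(x,y)=\alpha_t(x\cdot y)$ for all $x,y\in A[[t]]$.
   Context: A hom-associative $k$-algebra $(A,\star,\alpha)$ is a $k$-module $A$ with a $k$-bilinear operation $\star:A\times A\to A$ and a $k$-linear map $\alpha:A\to A$ (the twisting map) such that $\alpha(x)\star(y\star z)=(x\star y)\star\alpha(z)$ for all $x,y,z\in A$. Neither a unit nor multiplicativity of $\alpha$ is assumed. $(A,\star)$ is strongly degenerate if there exist $a\neq b$ in $A$ with $x\star a=x\star b$ and $a\star x=b\star x$ for all $x\in A$. $A[[t]]$ denotes the $k[[t]]$-module of formal power series $\sum_{i\ge 0}t^i a_i$ with $a_i\in A$. A formal (hom-associative) deformation of $(A,\star,\alpha)$ is a triple $(A[[t]],\mu_t,\alpha_t)$ where $\mu_t=\sum_{i\ge0}t^i\mu_i$ with $k$-bilinear maps $\mu_i:A\times A\to A$ and $\mu_0(a,b)=a\star b$, and $\alpha_t=\sum_{i\ge0}t^i\alpha_i$ with $k$-linear maps $\alpha_i:A\to A$ and $\alpha_0=\alpha$, both extended $k[[t]]$-(bi)linearly to power series in the usual way, i.e. $\mu_t(\sum_j t^ja_j,\sum_l t^lb_l)=\sum_{i,j,l}t^{i+j+l}\mu_i(a_j,b_l)$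 and $\alpha_t(\sum_j t^ja_j)=\sum_{i,j}t^{i+j}\alpha_i(a_j)$, such that $(A[[t]],\mu_t,\alpha_t)$ is hom-associative, i.e. $\mu_t(\alpha_t(x),\mu_t(y,z))=\mu_t(\mu_t(x,y),\alpha_t(z))$ for all $x,y,z\in A[[t]]$. *)

theory Defs
  imports "HOL-Algebra.Module"
begin

text \<open>
  Modules are those of \<^theory>\<open>HOL-Algebra.Module\<close>. Their records also carry the ring fields
  \<open>mult\<close> and \<open>one\<close>, which the \<open>module\<close> locale leaves unconstrained; the multiplication and the
  twisting map of an algebra are therefore separate functions, relevant on the carrier only.
\<close>

definition linear_map ::
  "('r, 'm) ring_scheme \<Rightarrow> ('r, 'a, 'n) module_scheme \<Rightarrow> ('a \<Rightarrow> 'a) \<Rightarrow> bool" where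
  "linear_map R M f \<longleftrightarrow>
     f \<in> carrier M \<rightarrow> carrier M \<and>
     (\<forall>x\<in>carrier M. \<forall>y\<in>carrier M. f (x \<oplus>\<^bsub>M\<^esub> y) = f x \<oplus>\<^bsub>M\<^esub> f y) \<and>
     (\<forall>c\<in>carrier R. \<forall>x\<in>carrier M. f (c \<odot>\<^bsub>M\<^esub> x) = c \<odot>\<^bsub>M\<^esub> f x)"

definition bilinear_map ::
  "('r, 'm) ring_scheme \<Rightarrow> ('r, 'a, 'n) module_scheme \<Rightarrow> ('a \<Rightarrow> 'a \<Rightarrow> 'a) \<Rightarrow> bool" where
  "bilinear_map R M f \<longleftrightarrow>
     (\<forall>x\<in>carrier M. linear_map R M (\<lambda>y. f x y)) \<and>
     (\<forall>y\<in>carrier M. linear_map R M (\<lambda>x. f x y))"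

definition associative_on :: "'a set \<Rightarrow> ('a \<Rightarrow> 'a \<Rightarrow> 'a) \<Rightarrow> bool" where
  "associative_on A p \<longleftrightarrow> (\<forall>x\<in>A. \<forall>y\<in>A. \<forall>z\<in>A. p (p x y) z = p x (p y z))"

definition hom_associative_on :: "'a set \<Rightarrow> ('a \<Rightarrow> 'a \<Rightarrow> 'a) \<Rightarrow> ('a \<Rightarrow> 'a) \<Rightarrow> bool" where
  "hom_associative_on A m f \<longleftrightarrow>
     (\<forall>x\<in>A. \<forall>y\<in>A. \<forall>z\<in>A. m (f x) (m y z) = m (m x y) (f z))"

definition hom_associative_algebra ::
  "('r, 'm) ring_scheme \<Rightarrow> ('r, 'a, 'n) module_scheme \<Rightarrow> ('a \<Rightarrow> 'a \<Rightarrow> 'a) \<Rightarrow> ('a \<Rightarrow> 'a) \<Rightarrow> bool" where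
  "hom_associative_algebra R M m f \<longleftrightarrow>
     module R M \<and> bilinear_map R M m \<and> linear_map R M f \<and> hom_associative_on (carrier M) m f"

definition strongly_degenerate_on :: "'a set \<Rightarrow> ('a \<Rightarrow> 'a \<Rightarrow> 'a) \<Rightarrow> bool" where
  "strongly_degenerate_on A m \<longleftrightarrow>
     (\<exists>a\<in>A. \<exists>b\<in>A. a \<noteq> b \<and> (\<forall>x\<in>A. m x a = m x b \<and> m a x = m b x))"

text \<open>A power series is its sequence of coefficients.\<close>

definition power_series_ring :: "('r, 'm) ring_scheme \<Rightarrow> (nat \<Rightarrow> 'r) ring" where
  "power_series_ring R =
     \<lparr>carrier = UNIV \<rightarrow> carrier R,
      monoid.mult = \<lambda>c d n. \<Oplus>\<^bsub>R\<^esub>i\<in>{..n}. c i \<otimes>\<^bsub>R\<^esub> d (n - i),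
      one = \<lambda>n. if n = 0 then \<one>\<^bsub>R\<^esub> else \<zero>\<^bsub>R\<^esub>,
      zero = \<lambda>n. \<zero>\<^bsub>R\<^esub>,
      add = \<lambda>c d n. c n \<oplus>\<^bsub>R\<^esub> d n\<rparr>"

definition power_series_module ::
  "('r, 'a, 'n) module_scheme \<Rightarrow> (nat \<Rightarrow> 'r, nat \<Rightarrow> 'a) module" where
  "power_series_module M =
     \<lparr>carrier = UNIV \<rightarrow> carrier M,
      monoid.mult = undefined,
      one = undefined,
      zero = \<lambda>n. \<zero>\<^bsub>M\<^esub>,
      add = \<lambda>x y n. x n \<oplus>\<^bsub>M\<^esub> y n,
      smult = \<lambda>c x n. \<Oplus>\<^bsub>M\<^esub>i\<in>{..n}. c i \<odot>\<^bsub>M\<^esub> x (n - i)\<rparr>"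

text \<open>
  The extensions of \<open>\<Sum>\<^sub>i t\<^sup>i \<mu>\<^sub>i\<close> and \<open>\<Sum>\<^sub>i t\<^sup>i \<alpha>\<^sub>i\<close> to power series, given by the
  coefficient of \<open>t\<^sup>n\<close> (a finite sum).
\<close>

definition extend_mult ::
  "('r, 'a, 'n) module_scheme \<Rightarrow> (nat \<Rightarrow> 'a \<Rightarrow> 'a \<Rightarrow> 'a) \<Rightarrow> (nat \<Rightarrow> 'a) \<Rightarrow> (nat \<Rightarrow> 'a) \<Rightarrow> nat \<Rightarrow> 'a" where
  "extend_mult M \<mu> x y =
     (\<lambda>n. \<Oplus>\<^bsub>M\<^esub>p\<in>{(i, j, l). i + j + l = n}. case p of (i, j, l) \<Rightarrow> \<mu> i (x j) (y l))"

definition extend_map ::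
  "('r, 'a, 'n) module_scheme \<Rightarrow> (nat \<Rightarrow> 'a \<Rightarrow> 'a) \<Rightarrow> (nat \<Rightarrow> 'a) \<Rightarrow> nat \<Rightarrow> 'a" where
  "extend_map M \<alpha> x =
     (\<lambda>n. \<Oplus>\<^bsub>M\<^esub>p\<in>{(i, j). i + j = n}. case p of (i, j) \<Rightarrow> \<alpha> i (x j))"

definition formal_deformation ::
  "('r, 'm) ring_scheme \<Rightarrow> ('r, 'a, 'n) module_scheme \<Rightarrow> ('a \<Rightarrow> 'a \<Rightarrow> 'a) \<Rightarrow> ('a \<Rightarrow> 'a) \<Rightarrow>
   (nat \<Rightarrow> 'a \<Rightarrow> 'a \<Rightarrow> 'a) \<Rightarrow> (nat \<Rightarrow> 'a \<Rightarrow> 'a) \<Rightarrow> bool" where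
  "formal_deformation R M m f \<mu> \<alpha> \<longleftrightarrow>
     (\<forall>i. bilinear_map R M (\<mu> i)) \<and>
     (\<forall>i. linear_map R M (\<alpha> i)) \<and>
     (\<forall>a\<in>carrier M. \<forall>b\<in>carrier M. \<mu> 0 a b = m a b) \<and>
     (\<forall>a\<in>carrier M. \<alpha> 0 a = f a) \<and>
     hom_associative_on (carrier (power_series_module M)) (extend_mult M \<mu>) (extend_map M \<alpha>)"

text \<open>A multiplication on a module is understood to be bilinear over its base ring.\<close>

definition is_twist ::
  "('r, 'm) ring_scheme \<Rightarrow> ('r, 'a, 'n) module_scheme \<Rightarrow> ('a \<Rightarrow> 'a \<Rightarrow> 'a) \<Rightarrow> ('a \<Rightarrow> 'a) \<Rightarrow> bool" where
  "is_twist R M m f \<longleftrightarrow>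
     (\<exists>p. bilinear_map R M p \<and> associative_on (carrier M) p \<and>
          (\<forall>x\<in>carrier M. \<forall>y\<in>carrier M. m x y = f (p x y)))"

end

theory Submission
  imports Defs
begin

text \<open>
  The theorem combines a statement about bare hom-associative structures with two remarks on
  power series.

  If \<open>\<alpha>\<close> is surjective and no two elements are indistinguishable under both left and right
  multiplication, then \<open>\<alpha>\<close> is injective (\<open>twist_inj\<close>) and \<open>x \<cdot> y = \<alpha>\<^sup>-\<^sup>1(x \<star> y)\<close> is associative
  (\<open>untwist_assoc\<close>), so the structure is a twist. No addition enters here. In both cases two
  elements \<open>a\<close>, \<open>b\<close> are to be identified, and surjectivity lets every factor be written as \<open>\<alpha> v\<close>, so
  that hom-associativity can always be used to move brackets. This shows that \<open>a\<close> and \<open>b\<close> agree in all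
  products with two further factors, placed on either side and in either order; cancelling
  the two factors one at a time gives \<open>a = b\<close>. For associativity, where \<open>a = \<alpha>\<^sup>-\<^sup>1(x \<star> y) \<star> z\<close> and
  \<open>b = x \<star> \<alpha>\<^sup>-\<^sup>1(y \<star> z)\<close>, the agreement of \<open>v \<star> (w \<star> a)\<close> and \<open>v \<star> (w \<star> b)\<close> is the heart of the
  matter (\<open>assoc_under_two_left\<close>). The other three placements of \<open>v\<close> and \<open>w\<close> reduce to it.

  Both hypotheses pass from \<open>A\<close> to \<open>A[[t]]\<close>. A preimage under \<open>\<alpha>\<^sub>t\<close> is found coefficient by
  coefficient, using surjectivity of \<open>\<alpha>\<^sub>0\<close> (\<open>extend_map_surjective\<close>). If two series are
  indistinguishable under \<open>\<mu>\<^sub>t\<close>, then multiplying by constants shows that their first differing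
  coefficients are indistinguishable under \<open>\<mu>\<^sub>0\<close> (\<open>extend_mult_nondegenerate\<close>). Finally, the product
  \<open>\<alpha>\<^sub>t\<^sup>-\<^sup>1(\<mu>\<^sub>t(x, y))\<close> is bilinear over \<open>k[[t]]\<close> because \<open>\<mu>\<^sub>t\<close> and \<open>\<alpha>\<^sub>t\<close> are
  (\<open>extend_mult_bilinear\<close>, \<open>extend_map_linear\<close>).
\<close>

section \<open>Hom-associative magmas with surjective twisting\<close>

locale surjective_hom_magma =
  fixes S :: "'a set" and mul :: "'a \<Rightarrow> 'a \<Rightarrow> 'a" (infixl "\<star>" 70) and \<alpha> :: "'a \<Rightarrow> 'a"
  assumes closed [simp]: "x \<in> S \<Longrightarrow> y \<in> S \<Longrightarrow> x \<star> y \<in> S"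
    and image: "\<alpha> ` S = S"
    and hom_assoc: "x \<in> S \<Longrightarrow> y \<in> S \<Longrightarrow> z \<in> S \<Longrightarrow> \<alpha> x \<star> (y \<star> z) = (x \<star> y) \<star> \<alpha> z"
    and separation: "a \<in> S \<Longrightarrow> b \<in> S \<Longrightarrow> (\<And>x. x \<in> S \<Longrightarrow> x \<star> a = x \<star> b) \<Longrightarrow>
      (\<And>x. x \<in> S \<Longrightarrow> a \<star> x = b \<star> x) \<Longrightarrow> a = b"
begin

lemma twist_closed [simp]: "x \<in> S \<Longrightarrow> \<alpha> x \<in> S"
  using image by blast

lemma twist_preimage:
  assumes "y \<in> S"
  obtains x where "x \<in> S" "y = \<alpha> x"
  using assms image by blast

text \<open>
  If \<open>\<alpha> a = \<alpha> b\<close>, hom-associativity gives at once \<open>v \<star> (w \<star> a) = v \<star> (w \<star> b)\<close> and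
  \<open>(a \<star> w) \<star> v = (b \<star> w) \<star> v\<close>. To compare \<open>(x \<star> a) \<star> w\<close> with \<open>(x \<star> b) \<star> w\<close>, a third factor on either
  side is used: moving brackets then brings \<open>a\<close> and \<open>b\<close> into one of the first two positions. The
  remaining products \<open>x \<star> (a \<star> w)\<close> are of this third form after moving brackets.
\<close>

lemma twist_inj: "inj_on \<alpha> S"
proof (rule inj_onI)
  fix a b assume ab [simp]: "a \<in> S" "b \<in> S" and eq: "\<alpha> a = \<alpha> b"
  have ll: "v \<star> (w \<star> a) = v \<star> (w \<star> b)" if [simp]: "v \<in> S" "w \<in> S" for v w
  proof -
    obtain v' where [simp]: "v' \<in> S" "v = \<alpha> v'" by (rule twist_preimage[of v]) simp
    show ?thesis by (simp add: hom_assoc eq)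
  qed
  have rr: "(a \<star> w) \<star> v = (b \<star> w) \<star> v" if [simp]: "v \<in> S" "w \<in> S" for v w
  proof -
    obtain v' where [simp]: "v' \<in> S" "v = \<alpha> v'" by (rule twist_preimage[of v]) simp
    show ?thesis by (simp add: hom_assoc[symmetric] eq)
  qed
  have lr: "(x \<star> a) \<star> w = (x \<star> b) \<star> w" if [simp]: "x \<in> S" "w \<in> S" for x w
  proof (rule separation)
    fix v assume [simp]: "v \<in> S"
    obtain v' where [simp]: "v' \<in> S" "v = \<alpha> v'" by (rule twist_preimage[of v]) simp
    show "v \<star> ((x \<star> a) \<star> w) = v \<star> ((x \<star> b) \<star> w)"
      by (simp add: hom_assoc ll)
    obtain w' where [simp]: "w' \<in> S" "w = \<alpha> w'" by (rule twist_preimage[of w]) simp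
    have "((x \<star> c) \<star> w) \<star> v = \<alpha> (\<alpha> x) \<star> ((c \<star> w') \<star> v')" if "c \<in> S" for c
      using that by (simp add: hom_assoc[symmetric])
    then show "((x \<star> a) \<star> w) \<star> v = ((x \<star> b) \<star> w) \<star> v"
      by (simp add: rr)
  qed simp_all
  have rl: "x \<star> (a \<star> w) = x \<star> (b \<star> w)" if [simp]: "x \<in> S" "w \<in> S" for x w
  proof -
    obtain x' where [simp]: "x' \<in> S" "x = \<alpha> x'" by (rule twist_preimage[of x]) simp
    show ?thesis by (simp add: hom_assoc lr)
  qed
  show "a = b"
  proof (rule separation)
    fix x assume [simp]: "x \<in> S"
    show "x \<star> a = x \<star> b" by (rule separation) (simp_all add: ll lr)
    show "a \<star> x = b \<star> x" by (rule separation) (simp_all add: rr rl)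
  qed simp_all
qed

definition untwist :: "'a \<Rightarrow> 'a" (\<open>\<beta>\<close>) where
  "\<beta> = inv_into S \<alpha>"

lemma untwist_closed [simp]: "x \<in> S \<Longrightarrow> \<beta> x \<in> S"
  unfolding untwist_def by (metis image inv_into_into)

lemma twist_untwist [simp]: "x \<in> S \<Longrightarrow> \<alpha> (\<beta> x) = x"
  unfolding untwist_def by (simp add: f_inv_into_f image)

lemma untwist_twist [simp]: "x \<in> S \<Longrightarrow> \<beta> (\<alpha> x) = x"
  unfolding untwist_def by (simp add: twist_inj)

lemma hom_assoc_left:
  assumes "x \<in> S" "y \<in> S" "z \<in> S"
  shows "x \<star> (y \<star> z) = (\<beta> x \<star> y) \<star> \<alpha> z"
  using hom_assoc[of "\<beta> x" y z] assms by simp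

lemma hom_assoc_right:
  assumes "x \<in> S" "y \<in> S" "z \<in> S"
  shows "(x \<star> y) \<star> z = \<alpha> x \<star> (y \<star> \<beta> z)"
  using hom_assoc[of x y "\<beta> z"] assms by simp

text \<open>
  Together with \<open>untwist_right_absorb\<close> this trades a factor on the right for one on the left: the
  two bracketings of \<open>x\<close>, \<open>y\<close>, \<open>z\<close>, followed by \<open>w\<close>, become the two bracketings of \<open>y\<close>, \<open>z\<close>,
  \<open>\<beta> w\<close>, preceded by \<open>\<alpha> x\<close>, but with their roles exchanged. So agreement after left
  multiplications implies agreement after right multiplications.
\<close>

lemma untwist_left_absorb:
  assumes [simp]: "x \<in> S" "y \<in> S" "z \<in> S" "w \<in> S"
  shows "\<beta> (x \<star> y) \<star> z \<star> w = \<alpha> x \<star> (y \<star> \<beta> (z \<star> \<beta> w))"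
proof -
  have "\<beta> (x \<star> y) \<star> z \<star> w = (x \<star> y) \<star> (z \<star> \<beta> w)"
    by (simp add: hom_assoc_right)
  also have "\<dots> = \<alpha> x \<star> (y \<star> \<beta> (z \<star> \<beta> w))"
    by (simp add: hom_assoc_right)
  finally show ?thesis .
qed

lemma untwist_right_absorb:
  assumes [simp]: "x \<in> S" "y \<in> S" "z \<in> S" "w \<in> S"
  shows "x \<star> \<beta> (y \<star> z) \<star> w = \<alpha> x \<star> (\<beta> (y \<star> z) \<star> \<beta> w)"
  by (simp add: hom_assoc_right)

text \<open>
  With \<open>q = \<beta>\<^sup>2 v \<star> \<beta> w\<close>, pulling \<open>v\<close> and \<open>w\<close> inwards turns the left-hand side into
  \<open>(q \<star> (x \<star> y)) \<star> \<alpha>\<^sup>2 z\<close> and the right-hand side into \<open>(q \<star> \<alpha> x) \<star> \<alpha> (y \<star> z)\<close>. These are joined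
  by three plain applications of hom-associativity. The second factor \<open>v\<close> is what brings
  \<open>\<beta> (x \<star> y)\<close> to the right end of a right-nested product, where its \<open>\<beta>\<close> is absorbed.
\<close>

lemma assoc_under_two_left:
  assumes [simp]: "v \<in> S" "w \<in> S" "x \<in> S" "y \<in> S" "z \<in> S"
  shows "v \<star> (w \<star> (\<beta> (x \<star> y) \<star> z)) = v \<star> (w \<star> (x \<star> \<beta> (y \<star> z)))"
proof -
  define q where "q = \<beta> (\<beta> v) \<star> \<beta> w"
  have [simp]: "q \<in> S" by (simp add: q_def)
  have "v \<star> (w \<star> (\<beta> (x \<star> y) \<star> z)) = v \<star> ((\<beta> w \<star> \<beta> (x \<star> y)) \<star> \<alpha> z)"
    by (simp add: hom_assoc_left[of w])
  also have "\<dots> = (\<beta> v \<star> (\<beta> w \<star> \<beta> (x \<star> y))) \<star> \<alpha> (\<alpha> z)"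
    by (simp add: hom_assoc_left[of v])
  also have "\<beta> v \<star> (\<beta> w \<star> \<beta> (x \<star> y)) = q \<star> (x \<star> y)"
    by (simp add: q_def hom_assoc_left[of "\<beta> v"])
  also have "(q \<star> (x \<star> y)) \<star> \<alpha> (\<alpha> z) = \<alpha> q \<star> ((x \<star> y) \<star> \<alpha> z)"
    by (simp add: hom_assoc)
  also have "\<dots> = \<alpha> q \<star> (\<alpha> x \<star> (y \<star> z))"
    by (simp add: hom_assoc)
  also have "\<dots> = (q \<star> \<alpha> x) \<star> \<alpha> (y \<star> z)"
    by (rule hom_assoc) simp_all
  also have "q \<star> \<alpha> x = \<beta> v \<star> (\<beta> w \<star> x)"
    by (simp add: q_def hom_assoc_left[of "\<beta> v"])
  also have "(\<beta> v \<star> (\<beta> w \<star> x)) \<star> \<alpha> (y \<star> z) = v \<star> ((\<beta> w \<star> x) \<star> (y \<star> z))"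
    by (simp add: hom_assoc_left[of v])
  also have "\<dots> = v \<star> (w \<star> (x \<star> \<beta> (y \<star> z)))"
    by (simp add: hom_assoc_left[of w])
  finally show ?thesis .
qed

lemma assoc_between:
  assumes [simp]: "v \<in> S" "w \<in> S" "x \<in> S" "y \<in> S" "z \<in> S"
  shows "w \<star> (\<beta> (x \<star> y) \<star> z \<star> v) = w \<star> (x \<star> \<beta> (y \<star> z) \<star> v)"
  by (simp add: untwist_left_absorb untwist_right_absorb assoc_under_two_left)

lemma assoc_left_then_right:
  assumes [simp]: "v \<in> S" "w \<in> S" "x \<in> S" "y \<in> S" "z \<in> S"
  shows "w \<star> (\<beta> (x \<star> y) \<star> z) \<star> v = w \<star> (x \<star> \<beta> (y \<star> z)) \<star> v"
  by (simp add: hom_assoc_right[of w] assoc_between)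

lemma assoc_under_two_right:
  assumes [simp]: "v \<in> S" "w \<in> S" "x \<in> S" "y \<in> S" "z \<in> S"
  shows "\<beta> (x \<star> y) \<star> z \<star> w \<star> v = x \<star> \<beta> (y \<star> z) \<star> w \<star> v"
  by (simp add: untwist_left_absorb untwist_right_absorb assoc_left_then_right)

theorem untwist_assoc:
  assumes [simp]: "x \<in> S" "y \<in> S" "z \<in> S"
  shows "\<beta> (\<beta> (x \<star> y) \<star> z) = \<beta> (x \<star> \<beta> (y \<star> z))"
proof -
  have "\<beta> (x \<star> y) \<star> z = x \<star> \<beta> (y \<star> z)"
  proof (rule separation)
    fix w assume [simp]: "w \<in> S"
    show "w \<star> (\<beta> (x \<star> y) \<star> z) = w \<star> (x \<star> \<beta> (y \<star> z))"
      by (rule separation) (simp_all add: assoc_under_two_left assoc_left_then_right)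
    show "\<beta> (x \<star> y) \<star> z \<star> w = x \<star> \<beta> (y \<star> z) \<star> w"
      by (rule separation) (simp_all add: assoc_between assoc_under_two_right)
  qed simp_all
  then show ?thesis by simp
qed

end

text \<open>
  The module operations are only required to be closed, so that the power series module can be
  used without verifying its axioms over \<open>k[[t]]\<close>.
\<close>

lemma is_twist_if_surjective:
  assumes add: "\<And>x y. x \<in> carrier M \<Longrightarrow> y \<in> carrier M \<Longrightarrow> x \<oplus>\<^bsub>M\<^esub> y \<in> carrier M"
    and smult: "\<And>c x. c \<in> carrier R \<Longrightarrow> x \<in> carrier M \<Longrightarrow> c \<odot>\<^bsub>M\<^esub> x \<in> carrier M"
    and bil: "bilinear_map R M m" and lin: "linear_map R M f"
    and hom: "hom_associative_on (carrier M) m f"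
    and nondeg: "\<not> strongly_degenerate_on (carrier M) m"
    and surj: "f ` carrier M = carrier M"
  shows "is_twist R M m f"
proof -
  have closed: "m x y \<in> carrier M" if "x \<in> carrier M" "y \<in> carrier M" for x y
    using bil that unfolding bilinear_map_def linear_map_def by blast
  interpret surjective_hom_magma "carrier M" m f
  proof
    fix a b
    assume "a \<in> carrier M" "b \<in> carrier M"
      and "\<And>x. x \<in> carrier M \<Longrightarrow> m x a = m x b" "\<And>x. x \<in> carrier M \<Longrightarrow> m a x = m b x"
    then show "a = b"
      using nondeg unfolding strongly_degenerate_on_def by blast
  qed (use closed surj hom in \<open>auto simp: hom_associative_on_def\<close>)
  have eqI: "untwist a = b" if "b \<in> carrier M" "a = f b" for a b
    using that by simp
  have "linear_map R M (\<lambda>x. untwist (g x))" if "linear_map R M g" for g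
    using that lin unfolding linear_map_def
    by (auto simp: Pi_iff add smult intro!: eqI)
  then have "bilinear_map R M (\<lambda>x y. untwist (m x y))"
    using bil by (simp add: bilinear_map_def)
  then show ?thesis
    unfolding is_twist_def associative_on_def
    by (intro exI[of _ "\<lambda>x y. untwist (m x y)"]) (simp add: untwist_assoc)
qed

section \<open>Finite sums and linear maps\<close>

context abelian_monoid
begin

lemma finsum_Sigma:
  assumes "finite B" "\<And>b. b \<in> B \<Longrightarrow> finite (F b)"
    and closed: "\<And>b a. b \<in> B \<Longrightarrow> a \<in> F b \<Longrightarrow> g b a \<in> carrier G"
  shows "(\<Oplus>b\<in>B. \<Oplus>a\<in>F b. g b a) = (\<Oplus>p\<in>Sigma B F. g (fst p) (snd p))"
proof -
  have "(\<Oplus>p\<in>Sigma B F. g (fst p) (snd p)) = (\<Oplus>p\<in>(\<Union>b\<in>B. Pair b ` F b). g (fst p) (snd p))"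
    by (rule arg_cong[where f = "finsum G _"]) auto
  also have "\<dots> = (\<Oplus>b\<in>B. \<Oplus>p\<in>Pair b ` F b. g (fst p) (snd p))"
    using assms by (intro add.finprod_UN_disjoint) (auto simp: pairwise_def disjnt_def)
  also have "\<dots> = (\<Oplus>b\<in>B. \<Oplus>a\<in>F b. g b a)"
  proof (intro finsum_cong')
    fix b assume "b \<in> B"
    then show "(\<Oplus>p\<in>Pair b ` F b. g (fst p) (snd p)) = (\<Oplus>a\<in>F b. g b a)"
      using closed by (subst finsum_reindex) (auto simp: inj_on_def)
  qed (use closed in \<open>auto intro!: finsum_closed\<close>)
  finally show ?thesis ..
qed

lemma finsum_reindex_inverse:
  assumes "\<And>a. a \<in> A \<Longrightarrow> h a \<in> B" "\<And>b. b \<in> B \<Longrightarrow> h' b \<in> A"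
    and "\<And>a. a \<in> A \<Longrightarrow> h' (h a) = a" "\<And>b. b \<in> B \<Longrightarrow> h (h' b) = b"
    and "\<And>a. a \<in> A \<Longrightarrow> f (h a) = g a"
    and "\<And>b. b \<in> B \<Longrightarrow> f b \<in> carrier G"
  shows "(\<Oplus>a\<in>A. g a) = (\<Oplus>b\<in>B. f b)"
proof -
  have "inj_on h A" by (metis assms(3) inj_onI)
  moreover have "B = h ` A" using assms by force
  ultimately have "(\<Oplus>b\<in>B. f b) = (\<Oplus>a\<in>A. f (h a))"
    using assms by (simp add: finsum_reindex Pi_iff)
  also have "\<dots> = (\<Oplus>a\<in>A. g a)"
    using assms by (intro finsum_cong') force+
  finally show ?thesis ..
qed

end

lemma finite_sum_pairs [simp]: "finite {p. fst p + snd p = (n::nat)}"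
  by (rule finite_subset[of _ "{..n} \<times> {..n}"]) auto

lemma linear_map_closed: "linear_map R M f \<Longrightarrow> x \<in> carrier M \<Longrightarrow> f x \<in> carrier M"
  unfolding linear_map_def by blast

lemma linear_map_cong:
  assumes "linear_map R M g" "\<And>x. x \<in> carrier M \<Longrightarrow> f x = g x"
    and "\<And>x y. x \<in> carrier M \<Longrightarrow> y \<in> carrier M \<Longrightarrow> x \<oplus>\<^bsub>M\<^esub> y \<in> carrier M"
    and "\<And>c x. c \<in> carrier R \<Longrightarrow> x \<in> carrier M \<Longrightarrow> c \<odot>\<^bsub>M\<^esub> x \<in> carrier M"
  shows "linear_map R M f"
  using assms unfolding linear_map_def by (simp add: Pi_iff)

lemma bilinear_map_closed:
  "bilinear_map R M m \<Longrightarrow> x \<in> carrier M \<Longrightarrow> y \<in> carrier M \<Longrightarrow> m x y \<in> carrier M"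
  unfolding bilinear_map_def by (blast intro: linear_map_closed)

context module
begin

lemma linear_map_zero:
  assumes "linear_map R M f"
  shows "f \<zero>\<^bsub>M\<^esub> = \<zero>\<^bsub>M\<^esub>"
proof -
  have "f (\<zero> \<odot>\<^bsub>M\<^esub> \<zero>\<^bsub>M\<^esub>) = \<zero> \<odot>\<^bsub>M\<^esub> f \<zero>\<^bsub>M\<^esub>"
    using assms unfolding linear_map_def by blast
  then show ?thesis
    using linear_map_closed[OF assms] by simp
qed

lemma linear_map_finsum:
  assumes "linear_map R M f" "finite I" "\<And>i. i \<in> I \<Longrightarrow> x i \<in> carrier M"
  shows "f (\<Oplus>\<^bsub>M\<^esub>i\<in>I. x i) = (\<Oplus>\<^bsub>M\<^esub>i\<in>I. f (x i))"
  using assms(2,3)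
proof (induction I)
  case empty
  then show ?case by (simp add: linear_map_zero[OF assms(1)])
next
  case (insert i I)
  have "f (x i \<oplus>\<^bsub>M\<^esub> (\<Oplus>\<^bsub>M\<^esub>i\<in>I. x i)) = f (x i) \<oplus>\<^bsub>M\<^esub> f (\<Oplus>\<^bsub>M\<^esub>i\<in>I. x i)"
    using assms(1) insert.prems unfolding linear_map_def by (simp add: Pi_iff)
  then show ?case
    using insert linear_map_closed[OF assms(1)] by (simp add: Pi_iff)
qed

lemma finsum_linear_map:
  assumes "finite I" "\<And>i. i \<in> I \<Longrightarrow> linear_map R M (F i)"
  shows "linear_map R M (\<lambda>b. \<Oplus>\<^bsub>M\<^esub>i\<in>I. F i b)"
proof -
  have F: "F i b \<in> carrier M" if "i \<in> I" "b \<in> carrier M" for i b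
    using that assms by (blast intro: linear_map_closed)
  show ?thesis
    unfolding linear_map_def
  proof (intro conjI ballI)
    fix x y assume "x \<in> carrier M" "y \<in> carrier M"
    moreover from this have "(\<Oplus>\<^bsub>M\<^esub>i\<in>I. F i (x \<oplus>\<^bsub>M\<^esub> y)) = (\<Oplus>\<^bsub>M\<^esub>i\<in>I. F i x \<oplus>\<^bsub>M\<^esub> F i y)"
      using F assms(2) by (intro M.finsum_cong') (auto simp: linear_map_def)
    ultimately show "(\<Oplus>\<^bsub>M\<^esub>i\<in>I. F i (x \<oplus>\<^bsub>M\<^esub> y)) = (\<Oplus>\<^bsub>M\<^esub>i\<in>I. F i x) \<oplus>\<^bsub>M\<^esub> (\<Oplus>\<^bsub>M\<^esub>i\<in>I. F i y)"
      using F by (simp add: Pi_iff)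
  next
    fix c x assume "c \<in> carrier R" "x \<in> carrier M"
    moreover from this have "(\<Oplus>\<^bsub>M\<^esub>i\<in>I. F i (c \<odot>\<^bsub>M\<^esub> x)) = (\<Oplus>\<^bsub>M\<^esub>i\<in>I. c \<odot>\<^bsub>M\<^esub> F i x)"
      using F assms(2) by (intro M.finsum_cong') (auto simp: linear_map_def)
    ultimately show "(\<Oplus>\<^bsub>M\<^esub>i\<in>I. F i (c \<odot>\<^bsub>M\<^esub> x)) = c \<odot>\<^bsub>M\<^esub> (\<Oplus>\<^bsub>M\<^esub>i\<in>I. F i x)"
      using F assms(1) by (simp add: finsum_smult_ldistr Pi_iff)
  qed (use F in \<open>auto intro!: M.finsum_closed\<close>)
qed

end

section \<open>Extending linear and bilinear maps to power series\<close>

context module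
begin

lemma extend_map_closed:
  assumes "\<And>i. linear_map R M (\<nu> i)" "\<And>i. x i \<in> carrier M"
  shows "extend_map M \<nu> x n \<in> carrier M"
  unfolding extend_map_def
  using linear_map_closed[OF assms(1)] assms(2) by (intro M.finsum_closed) auto

lemma extend_map_leading:
  assumes "\<And>i. linear_map R M (\<nu> i)" "\<And>i. i \<le> n \<Longrightarrow> x i \<in> carrier M"
  shows "extend_map M \<nu> x n = \<nu> 0 (x n) \<oplus>\<^bsub>M\<^esub> (\<Oplus>\<^bsub>M\<^esub>j\<in>{..<n}. \<nu> (n - j) (x j))"
proof -
  have closed: "\<nu> i (x j) \<in> carrier M" if "j \<le> n" for i j
    using that assms by (blast intro: linear_map_closed)
  have "extend_map M \<nu> x n = (\<Oplus>\<^bsub>M\<^esub>j\<in>{..n}. \<nu> (n - j) (x j))"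
    unfolding extend_map_def
    by (rule M.finsum_reindex_inverse[where h = snd and h' = "\<lambda>j. (n - j, j)"])
      (auto simp: closed)
  then show ?thesis
    using M.add.finprod_Suc3[of "\<lambda>j. \<nu> (n - j) (x j)" n] closed by (simp add: Pi_iff)
qed

text \<open>
  For the scalar multiplication both sides are the sum of \<open>c\<^sub>l \<nu>\<^sub>i(x\<^sub>j)\<close> over all \<open>i + j + l = n\<close>,
  grouped by \<open>i\<close> on the left and by \<open>l\<close> on the right.
\<close>

lemma extend_map_linear:
  assumes lin: "\<And>i. linear_map R M (\<nu> i)"
  shows "linear_map (power_series_ring R) (power_series_module M) (extend_map M \<nu>)"
proof -
  have closed: "\<nu> i b \<in> carrier M" if "b \<in> carrier M" for i b
    using lin that by (rule linear_map_closed)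
  have add: "extend_map M \<nu> (\<lambda>n. x n \<oplus>\<^bsub>M\<^esub> y n) n = extend_map M \<nu> x n \<oplus>\<^bsub>M\<^esub> extend_map M \<nu> y n"
    if x: "\<And>n. x n \<in> carrier M" and y: "\<And>n. y n \<in> carrier M" for x y n
  proof -
    have "extend_map M \<nu> (\<lambda>n. x n \<oplus>\<^bsub>M\<^esub> y n) n =
        (\<Oplus>\<^bsub>M\<^esub>p\<in>{(i, j). i + j = n}. (case p of (i, j) \<Rightarrow> \<nu> i (x j)) \<oplus>\<^bsub>M\<^esub> (case p of (i, j) \<Rightarrow> \<nu> i (y j)))"
      unfolding extend_map_def using lin x y closed
      by (intro M.finsum_cong') (auto simp: linear_map_def)
    then show ?thesis
      unfolding extend_map_def using x y closed by (simp add: Pi_iff case_prod_unfold)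
  qed
  have smult: "extend_map M \<nu> (\<lambda>n. \<Oplus>\<^bsub>M\<^esub>l\<in>{..n}. c l \<odot>\<^bsub>M\<^esub> x (n - l)) n =
      (\<Oplus>\<^bsub>M\<^esub>l\<in>{..n}. c l \<odot>\<^bsub>M\<^esub> extend_map M \<nu> x (n - l))"
    if c: "\<And>n. c n \<in> carrier R" and x: "\<And>n. x n \<in> carrier M" for c x n
  proof -
    let ?g = "\<lambda>l p. c l \<odot>\<^bsub>M\<^esub> \<nu> (fst p) (x (snd p))"
    have g: "?g l p \<in> carrier M" for l p
      using c x closed by blast
    have "extend_map M \<nu> (\<lambda>n. \<Oplus>\<^bsub>M\<^esub>l\<in>{..n}. c l \<odot>\<^bsub>M\<^esub> x (n - l)) n =
        (\<Oplus>\<^bsub>M\<^esub>p\<in>{p. fst p + snd p = n}. \<Oplus>\<^bsub>M\<^esub>l\<in>{..snd p}. ?g l (fst p, snd p - l))"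
      unfolding extend_map_def
    proof (intro M.finsum_cong')
      fix p assume "p \<in> {p. fst p + snd p = n}"
      have "\<nu> (fst p) (\<Oplus>\<^bsub>M\<^esub>l\<in>{..snd p}. c l \<odot>\<^bsub>M\<^esub> x (snd p - l)) =
          (\<Oplus>\<^bsub>M\<^esub>l\<in>{..snd p}. \<nu> (fst p) (c l \<odot>\<^bsub>M\<^esub> x (snd p - l)))"
        using c x by (intro linear_map_finsum lin) auto
      also have "\<dots> = (\<Oplus>\<^bsub>M\<^esub>l\<in>{..snd p}. ?g l (fst p, snd p - l))"
        using lin c x g by (intro M.finsum_cong') (auto simp: linear_map_def)
      finally show "(case p of (i, j) \<Rightarrow> \<nu> i (\<Oplus>\<^bsub>M\<^esub>l\<in>{..j}. c l \<odot>\<^bsub>M\<^esub> x (j - l))) = \<dots>"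
        by (simp add: split_beta)
    qed (use g in \<open>auto intro!: M.finsum_closed\<close>)
    also have "\<dots> = (\<Oplus>\<^bsub>M\<^esub>q\<in>(SIGMA p:{p. fst p + snd p = n}. {..snd p}).
        ?g (snd q) (fst (fst q), snd (fst q) - snd q))"
      using g by (intro M.finsum_Sigma) auto
    also have "\<dots> = (\<Oplus>\<^bsub>M\<^esub>q\<in>(SIGMA l:{..n}. {p. fst p + snd p = n - l}). ?g (fst q) (snd q))"
      by (rule M.finsum_reindex_inverse[where h = "\<lambda>((i, j), l). (l, (i, j - l))"
            and h' = "\<lambda>(l, (i, j)). ((i, j + l), l)"])
        (use g in auto)
    also have "\<dots> = (\<Oplus>\<^bsub>M\<^esub>l\<in>{..n}. \<Oplus>\<^bsub>M\<^esub>p\<in>{p. fst p + snd p = n - l}. ?g l p)"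
      using g by (intro M.finsum_Sigma[symmetric]) auto
    also have "\<dots> = (\<Oplus>\<^bsub>M\<^esub>l\<in>{..n}. c l \<odot>\<^bsub>M\<^esub> extend_map M \<nu> x (n - l))"
    proof (intro M.finsum_cong')
      fix l
      show "(\<Oplus>\<^bsub>M\<^esub>p\<in>{p. fst p + snd p = n - l}. ?g l p) = c l \<odot>\<^bsub>M\<^esub> extend_map M \<nu> x (n - l)"
        unfolding extend_map_def split_beta using c x closed
        by (subst finsum_smult_ldistr) (auto simp: case_prod_unfold)
    qed (use c extend_map_closed[OF lin x] in auto)
    finally show ?thesis .
  qed
  show ?thesis
    unfolding linear_map_def power_series_ring_def power_series_module_def
    using add smult extend_map_closed[OF lin] by (auto simp: Pi_iff fun_eq_iff)
qed

text \<open>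
  Multiplication by a fixed series is itself the extension of a family of linear maps.
  Bilinearity and the comparison of lowest coefficients thereby reduce to \<open>extend_map\<close>.
\<close>

lemma extend_mult_left:
  assumes "\<And>i. bilinear_map R M (\<mu> i)" "\<And>i. x i \<in> carrier M" "\<And>i. y i \<in> carrier M"
  shows "extend_mult M \<mu> x y =
    extend_map M (\<lambda>s b. \<Oplus>\<^bsub>M\<^esub>p\<in>{p. fst p + snd p = s}. \<mu> (fst p) (x (snd p)) b) y"
proof
  fix n
  have closed: "\<mu> i (x j) (y l) \<in> carrier M" for i j l
    using assms by (blast intro: bilinear_map_closed)
  have "extend_mult M \<mu> x y n =
      (\<Oplus>\<^bsub>M\<^esub>q\<in>(SIGMA r:{r. fst r + snd r = n}. {p. fst p + snd p = fst r}).
        \<mu> (fst (snd q)) (x (snd (snd q))) (y (snd (fst q))))"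
    unfolding extend_mult_def
    by (rule M.finsum_reindex_inverse[where h = "\<lambda>(i, j, l). ((i + j, l), (i, j))"
          and h' = "\<lambda>((s, l), (i, j)). (i, j, l)"])
      (auto simp: closed)
  also have "\<dots> = (\<Oplus>\<^bsub>M\<^esub>r\<in>{r. fst r + snd r = n}.
      \<Oplus>\<^bsub>M\<^esub>p\<in>{p. fst p + snd p = fst r}. \<mu> (fst p) (x (snd p)) (y (snd r)))"
    using closed by (intro M.finsum_Sigma[symmetric]) auto
  finally show "extend_mult M \<mu> x y n =
      extend_map M (\<lambda>s b. \<Oplus>\<^bsub>M\<^esub>p\<in>{p. fst p + snd p = s}. \<mu> (fst p) (x (snd p)) b) y n"
    unfolding extend_map_def by (simp add: case_prod_unfold)
qed

lemma extend_mult_right: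
  assumes "\<And>i. bilinear_map R M (\<mu> i)" "\<And>i. x i \<in> carrier M" "\<And>i. y i \<in> carrier M"
  shows "extend_mult M \<mu> x y =
    extend_map M (\<lambda>s a. \<Oplus>\<^bsub>M\<^esub>p\<in>{p. fst p + snd p = s}. \<mu> (fst p) a (y (snd p))) x"
proof -
  have "extend_mult M \<mu> x y = extend_mult M (\<lambda>i a b. \<mu> i b a) y x"
    unfolding extend_mult_def
  proof
    fix n
    show "(\<Oplus>\<^bsub>M\<^esub>p\<in>{(i, j, l). i + j + l = n}. case p of (i, j, l) \<Rightarrow> \<mu> i (x j) (y l)) =
        (\<Oplus>\<^bsub>M\<^esub>p\<in>{(i, j, l). i + j + l = n}. case p of (i, j, l) \<Rightarrow> \<mu> i (x l) (y j))"
      by (rule M.finsum_reindex_inverse[where h = "\<lambda>(i, j, l). (i, l, j)"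
            and h' = "\<lambda>(i, j, l). (i, l, j)"])
        (use assms in \<open>auto intro: bilinear_map_closed\<close>)
  qed
  then show ?thesis
    using assms by (simp add: extend_mult_left bilinear_map_def)
qed

lemma linear_coefficient:
  fixes \<mu> :: "nat \<Rightarrow> 'c \<Rightarrow> 'c \<Rightarrow> 'c" and s :: nat
  assumes "\<And>i. bilinear_map R M (\<mu> i)" "\<And>i. x i \<in> carrier M"
  shows "linear_map R M (\<lambda>b. \<Oplus>\<^bsub>M\<^esub>p\<in>{p. fst p + snd p = s}. \<mu> (fst p) (x (snd p)) b)"
    and "linear_map R M (\<lambda>a. \<Oplus>\<^bsub>M\<^esub>p\<in>{p. fst p + snd p = s}. \<mu> (fst p) a (x (snd p)))"
  using assms by (auto intro!: finsum_linear_map simp: bilinear_map_def)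

lemma power_series_add_closed:
  assumes "x \<in> carrier (power_series_module M)" "y \<in> carrier (power_series_module M)"
  shows "x \<oplus>\<^bsub>power_series_module M\<^esub> y \<in> carrier (power_series_module M)"
  using assms by (auto simp: power_series_module_def Pi_iff)

lemma power_series_smult_closed:
  assumes "c \<in> carrier (power_series_ring R)" "x \<in> carrier (power_series_module M)"
  shows "c \<odot>\<^bsub>power_series_module M\<^esub> x \<in> carrier (power_series_module M)"
  using assms
  by (auto simp: power_series_module_def power_series_ring_def Pi_iff intro!: M.finsum_closed)

lemma extend_mult_bilinear:
  assumes "\<And>i. bilinear_map R M (\<mu> i)"
  shows "bilinear_map (power_series_ring R) (power_series_module M) (extend_mult M \<mu>)"
proof -
  have car: "x \<in> carrier (power_series_module M) \<Longrightarrow> x i \<in> carrier M" for x i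
    by (auto simp: power_series_module_def)
  note closed = power_series_add_closed power_series_smult_closed
  show ?thesis
    unfolding bilinear_map_def
  proof (intro conjI ballI)
    fix x assume "x \<in> carrier (power_series_module M)"
    with assms show "linear_map (power_series_ring R) (power_series_module M) (extend_mult M \<mu> x)"
      by (intro linear_map_cong[OF extend_map_linear[OF linear_coefficient(1)] extend_mult_left])
        (auto intro: closed car)
  next
    fix y assume "y \<in> carrier (power_series_module M)"
    with assms show "linear_map (power_series_ring R) (power_series_module M) (\<lambda>x. extend_mult M \<mu> x y)"
      by (intro linear_map_cong[OF extend_map_linear[OF linear_coefficient(2)] extend_mult_right])
        (auto intro: closed car)
  qed
qed

lemma extend_map_surjective:
  assumes lin: "\<And>i. linear_map R M (\<alpha> i)" and surj: "\<alpha> 0 ` carrier M = carrier M"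
  shows "extend_map M \<alpha> ` carrier (power_series_module M) = carrier (power_series_module M)"
proof (intro subset_antisym subsetI)
  fix y assume "y \<in> extend_map M \<alpha> ` carrier (power_series_module M)"
  then show "y \<in> carrier (power_series_module M)"
    using extend_map_closed[OF lin] by (auto simp: power_series_module_def Pi_iff)
next
  fix y assume "y \<in> carrier (power_series_module M)"
  then have y: "y n \<in> carrier M" for n by (auto simp: power_series_module_def)
  define tail where "tail x n = (\<Oplus>\<^bsub>M\<^esub>j\<in>{..<n}. \<alpha> (n - j) (x j))" for x :: "nat \<Rightarrow> 'c" and n
  \<comment> \<open>Asking the earlier coefficients to lie in the carrier makes the value of \<open>P x n r\<close> depend on
    \<open>x\<close> below \<open>n\<close> only; finite sums can be compared termwise only inside the carrier.\<close>
  define P where "P x n r \<longleftrightarrow> (\<forall>j<n. x j \<in> carrier M) \<and> r \<in> carrier M \<and>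
      \<alpha> 0 r \<oplus>\<^bsub>M\<^esub> tail x n = y n" for x n r
  have tail: "tail x n \<in> carrier M" if "\<forall>j<n. x j \<in> carrier M" for x n
    unfolding tail_def using that by (intro M.finsum_closed) (auto intro: linear_map_closed lin)
  have "\<exists>x. \<forall>n. P x n (x n)"
  proof (rule dependent_wellorder_choice)
    fix n r and x x' :: "nat \<Rightarrow> 'c"
    assume eq: "\<And>j. j < n \<Longrightarrow> x j = x' j"
    have "tail x n = tail x' n" if "\<forall>j<n. x' j \<in> carrier M"
      unfolding tail_def using that eq by (intro M.finsum_cong') (auto intro: linear_map_closed lin)
    then show "P x n r = P x' n r"
      unfolding P_def using eq by auto
  next
    fix n and x :: "nat \<Rightarrow> 'c"
    assume "\<And>j. j < n \<Longrightarrow> P x j (x j)"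
    then have x: "\<forall>j<n. x j \<in> carrier M" by (simp add: P_def)
    have "y n \<ominus>\<^bsub>M\<^esub> tail x n \<in> \<alpha> 0 ` carrier M"
      using surj y tail[OF x] by simp
    then obtain r where "r \<in> carrier M" "\<alpha> 0 r = y n \<ominus>\<^bsub>M\<^esub> tail x n"
      by auto
    then show "\<exists>r. P x n r"
      using x y[of n] tail[OF x] by (auto simp: P_def M.minus_eq M.a_assoc M.l_neg)
  qed
  then obtain x where "\<And>n. P x n (x n)" by blast
  then have "x \<in> carrier (power_series_module M)" "extend_map M \<alpha> x = y"
    by (auto simp: P_def tail_def power_series_module_def extend_map_leading[OF lin])
  then show "y \<in> extend_map M \<alpha> ` carrier (power_series_module M)" by blast
qed

lemma extend_map_eq_leading:
  assumes "\<And>i. linear_map R M (\<nu> i)" "\<And>i. x i \<in> carrier M" "\<And>i. y i \<in> carrier M"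
    and "\<forall>i<n. x i = y i" and "extend_map M \<nu> x n = extend_map M \<nu> y n"
  shows "\<nu> 0 (x n) = \<nu> 0 (y n)"
proof -
  have closed: "\<nu> i (y j) \<in> carrier M" "\<nu> i (x j) \<in> carrier M" for i j
    using assms by (blast intro: linear_map_closed)+
  have "(\<Oplus>\<^bsub>M\<^esub>j\<in>{..<n}. \<nu> (n - j) (x j)) = (\<Oplus>\<^bsub>M\<^esub>j\<in>{..<n}. \<nu> (n - j) (y j))"
    using assms(4) closed by (intro M.finsum_cong') auto
  then show ?thesis
    using assms(5) closed by (simp add: extend_map_leading assms(1-3) Pi_iff)
qed

lemma extend_mult_nondegenerate:
  assumes bil: "\<And>i. bilinear_map R M (\<mu> i)"
    and nondeg: "\<not> strongly_degenerate_on (carrier M) (\<mu> 0)"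
  shows "\<not> strongly_degenerate_on (carrier (power_series_module M)) (extend_mult M \<mu>)"
proof
  assume "strongly_degenerate_on (carrier (power_series_module M)) (extend_mult M \<mu>)"
  then obtain a b where ab: "\<And>i. a i \<in> carrier M" "\<And>i. b i \<in> carrier M" and "a \<noteq> b"
    and eq: "\<And>x. (\<And>i. x i \<in> carrier M) \<Longrightarrow> extend_mult M \<mu> x a = extend_mult M \<mu> x b"
      "\<And>x. (\<And>i. x i \<in> carrier M) \<Longrightarrow> extend_mult M \<mu> a x = extend_mult M \<mu> b x"
    unfolding strongly_degenerate_on_def power_series_module_def
    by (clarsimp simp: Pi_iff) blast
  define n where "n = (LEAST n. a n \<noteq> b n)"
  have n: "a n \<noteq> b n"
    unfolding n_def using \<open>a \<noteq> b\<close> LeastI_ex[of "\<lambda>n. a n \<noteq> b n"] by auto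
  have below: "\<forall>i<n. a i = b i"
    unfolding n_def by (auto dest: not_less_Least)
  have zero: "{p::nat \<times> nat. fst p + snd p = 0} = {(0, 0)}" by auto
  have "\<mu> 0 w (a n) = \<mu> 0 w (b n) \<and> \<mu> 0 (a n) w = \<mu> 0 (b n) w" if w: "w \<in> carrier M" for w
  proof
    note closed = bilinear_map_closed[OF bil]
    let ?l = "\<lambda>s c. \<Oplus>\<^bsub>M\<^esub>p\<in>{p. fst p + snd p = s}. \<mu> (fst p) w c"
    have lin_l: "linear_map R M (?l s)" for s
      using bil w by (rule linear_coefficient(1))
    have "extend_map M ?l a n = extend_map M ?l b n"
      using eq(1)[of "\<lambda>_. w"] w by (simp add: extend_mult_left bil ab)
    then have "?l 0 (a n) = ?l 0 (b n)"
      by (rule extend_map_eq_leading[where \<nu> = ?l, OF lin_l ab below])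
    then show "\<mu> 0 w (a n) = \<mu> 0 w (b n)"
      unfolding zero by (simp add: closed w ab)
    let ?r = "\<lambda>s c. \<Oplus>\<^bsub>M\<^esub>p\<in>{p. fst p + snd p = s}. \<mu> (fst p) c w"
    have lin_r: "linear_map R M (?r s)" for s
      using bil w by (rule linear_coefficient(2))
    have "extend_map M ?r a n = extend_map M ?r b n"
      using eq(2)[of "\<lambda>_. w"] w by (simp add: extend_mult_right bil ab)
    then have "?r 0 (a n) = ?r 0 (b n)"
      by (rule extend_map_eq_leading[where \<nu> = ?r, OF lin_r ab below])
    then show "\<mu> 0 (a n) w = \<mu> 0 (b n) w"
      unfolding zero by (simp add: closed w ab)
  qed
  then show False
    using nondeg n ab unfolding strongly_degenerate_on_def by blast
qed

end

section \<open>Deformations with surjective twisting\<close>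

theorem mainTheorem4:
  fixes k :: "('r, 'm) ring_scheme"
    and A :: "('r, 'a, 'n) module_scheme"
    and star :: "'a \<Rightarrow> 'a \<Rightarrow> 'a"
    and twist :: "'a \<Rightarrow> 'a"
    and \<mu> :: "nat \<Rightarrow> 'a \<Rightarrow> 'a \<Rightarrow> 'a"
    and \<alpha> :: "nat \<Rightarrow> 'a \<Rightarrow> 'a"
  assumes "cring k"
    and "hom_associative_algebra k A star twist"
    and "\<not> strongly_degenerate_on (carrier A) star"
    and "twist ` carrier A = carrier A"
    and "formal_deformation k A star twist \<mu> \<alpha>"
  shows "is_twist (power_series_ring k) (power_series_module A)
           (extend_mult A \<mu>) (extend_map A \<alpha>)"
proof -
  interpret module k A
    using assms(2) by (simp add: hom_associative_algebra_def)
  have bil: "\<And>i. bilinear_map k A (\<mu> i)" and lin: "\<And>i. linear_map k A (\<alpha> i)"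
    and \<mu>0: "\<And>a b. a \<in> carrier A \<Longrightarrow> b \<in> carrier A \<Longrightarrow> \<mu> 0 a b = star a b"
    and \<alpha>0: "\<And>a. a \<in> carrier A \<Longrightarrow> \<alpha> 0 a = twist a"
    and hom: "hom_associative_on (carrier (power_series_module A))
      (extend_mult A \<mu>) (extend_map A \<alpha>)"
    using assms(5) by (auto simp: formal_deformation_def)
  have "\<alpha> 0 ` carrier A = carrier A"
    using assms(4) \<alpha>0 by simp
  moreover have "\<not> strongly_degenerate_on (carrier A) (\<mu> 0)"
    using assms(3) \<mu>0 unfolding strongly_degenerate_on_def by simp
  ultimately show ?thesis
    by (intro is_twist_if_surjective power_series_add_closed power_series_smult_closed
        extend_mult_bilinear extend_map_linear extend_mult_nondegenerate extend_map_surjective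
        bil lin hom)
qed

end
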